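(* Let $(G,i)$ be a rooted graph with $\xi\xi(G,i) = k+\ell$ for some integers $k \leq \ell \leq k+1$. Then (a) $e(G) + 1 \geq \binom{k+2}{2}$ if $k = \ell$; and (b) $e(G-i) + 1 \geq \binom{\ell+1}{2}$ if $k < \ell$. Overall, setting $m = \left\lceil \frac{\xi\xi(G,i)+3}{2}\right\rceil$, one has $e(G) + 1 \geq \binom{m}{2}$.
   Context: All graphs are finite and simple; $e(G)$ is the number of edges of $G$. For a graph $G$ on $n$ vertices labeled $1,\dots,n$, $\mathcal{S}(G)$ is the set of $n\times n$ real symmetric matrices whose off-diagonal $(p,q)$-entry is nonzero iff $\{p,q\}\in E(G)$ (diagonal arbitrary). $A(i)$ is $A$ with row and column $i$ deleted; $(AX)(i,:]$ is $AX$ with row $i$ deleted; $\circ$ is the entrywise product. The $i$-nullity pair of $A$ is $(\operatorname{null}(A),\operatorname{null}(A(i)))$. A symmetric $A$ has $i$-SNIP if the only symmetric $X$ with $A\circ X=O$, $I\circ X=O$, $(AX)(i,:]=O$ is $X=O$. For a rooted graph $(G,i)$, $\xi\xi(G,i)$ is the maximum of $k+\ell$ over pairs $(k,\ell)$ with $k\le\ell$ such that some $A\in\mathcal{S}(G)$ with $i$-SNIP has $i$-nullity pair $(k,\ell)$ (for such pairs necessarily $\ell\le k+1$). *)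

theory Defs
  imports
    "Jordan_Normal_Form.Determinant"
    "Jordan_Normal_Form.Matrix_Kernel"
begin

text \<open>A graph on \<open>n\<close> vertices has vertex labels \<open>0, \<dots>, n - 1\<close>, matching the index range of
  \<open>carrier_mat n n\<close>; it is given by \<open>n\<close> and its set of two-element edges.\<close>

definition simple_graph :: "nat \<Rightarrow> nat set set \<Rightarrow> bool" where
  "simple_graph n E \<longleftrightarrow> (\<forall>e\<in>E. e \<subseteq> {..<n} \<and> card e = 2)"

definition rooted_graph :: "nat \<Rightarrow> nat set set \<Rightarrow> nat \<Rightarrow> bool" where
  "rooted_graph n E i \<longleftrightarrow> simple_graph n E \<and> i < n"

text \<open>The edge set of the vertex-deleted graph; the remaining vertices are not relabelled.\<close>

definition del_vertex :: "nat set set \<Rightarrow> nat \<Rightarrow> nat set set" where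
  "del_vertex E i = {e \<in> E. i \<notin> e}"

definition sym_mats :: "nat \<Rightarrow> real mat set" where
  "sym_mats n = {A \<in> carrier_mat n n. transpose_mat A = A}"

definition graph_mats :: "nat \<Rightarrow> nat set set \<Rightarrow> real mat set" where
  "graph_mats n E = {A \<in> sym_mats n.
     \<forall>p<n. \<forall>q<n. p \<noteq> q \<longrightarrow> (A $$ (p, q) \<noteq> 0 \<longleftrightarrow> {p, q} \<in> E)}"

definition hadamard_mat :: "real mat \<Rightarrow> real mat \<Rightarrow> real mat" where
  "hadamard_mat A B = mat (dim_row A) (dim_col A) (\<lambda>(p, q). A $$ (p, q) * B $$ (p, q))"

definition del_row :: "real mat \<Rightarrow> nat \<Rightarrow> real mat" where
  "del_row A i = mat (dim_row A - 1) (dim_col A)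
     (\<lambda>(p, q). A $$ (if p < i then p else Suc p, q))"

definition nullity_pair :: "real mat \<Rightarrow> nat \<Rightarrow> nat \<times> nat" where
  "nullity_pair A i = (kernel_dim A, kernel_dim (mat_delete A i i))"

definition has_SNIP :: "nat \<Rightarrow> real mat \<Rightarrow> nat \<Rightarrow> bool" where
  "has_SNIP n A i \<longleftrightarrow> A \<in> sym_mats n \<and>
     (\<forall>X \<in> sym_mats n.
        hadamard_mat A X = 0\<^sub>m n n \<and> hadamard_mat (1\<^sub>m n) X = 0\<^sub>m n n \<and>
        del_row (A * X) i = 0\<^sub>m (n - 1) n \<longrightarrow> X = 0\<^sub>m n n)"

text \<open>For \<open>i < n\<close> the set below is finite, since both nullities are at most \<open>n\<close>, and nonempty:
  a matrix of the graph with large enough diagonal is positive definite, hence has the SNIP with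
  nullity pair \<open>(0, 0)\<close>. So \<open>Max\<close> is a genuine maximum.\<close>

definition xixi :: "nat \<Rightarrow> nat set set \<Rightarrow> nat \<Rightarrow> nat" where
  "xixi n E i = Max {k + l | k l. k \<le> l \<and>
     (\<exists>A \<in> graph_mats n E. has_SNIP n A i \<and> nullity_pair A i = (k, l))}"

end

theory Submission
  imports Defs
begin

text \<open>Let \<open>A\<close> attain \<open>\<xi>\<xi>(G,i) = k + l\<close> and let \<open>W\<close> be the space of vectors \<open>x\<close> such that \<open>Ax\<close> vanishes
  off the root \<open>i\<close>. It has dimension \<open>k + 1\<close>, and all its vectors vanish at \<open>i\<close> exactly if \<open>l = k + 1\<close>;
  in that case \<open>G\<close> is replaced by \<open>G - i\<close>. The SNIP forces \<open>W\<close> to be supported on a single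
  connected component \<open>R\<close>: otherwise \<open>X = wy\<^sup>T + yw\<^sup>T\<close>, with \<open>w\<close> and \<open>y\<close> in \<open>W\<close> supported on and off
  \<open>R\<close>, violates it. The symmetric matrices with columns in \<open>W\<close> form a space of dimension
  \<open>binomial(k + 2, 2)\<close>, and by the SNIP such a matrix is zero once its diagonal entries and its entries
  at edges in \<open>R\<close> vanish. Of these conditions, the ones at the edges of a spanning tree of \<open>R\<close> are
  redundant, so there are at most \<open>|E(R)| + |R| - (|R| - 1) = |E(R)| + 1\<close> of them.\<close>

section \<open>Linear algebra in coordinates\<close>

text \<open>Gaussian elimination, by induction on the equations: an equation with a pivot
  \<open>a i0 j0\<close> removes the unknown \<open>j0\<close> from the others, and both counts drop
  by one.\<close>

lemma underdetermined_system:
  fixes a :: "'b \<Rightarrow> 'c \<Rightarrow> 'a::field"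
  assumes "finite I" "finite J" "card I < card J"
  shows "\<exists>c. (\<exists>j\<in>J. c j \<noteq> 0) \<and> (\<forall>i\<in>I. (\<Sum>j\<in>J. a i j * c j) = 0)"
  using assms
proof (induction I arbitrary: J a rule: finite_induct)
  case empty
  then have "J \<noteq> {}" by auto
  then show ?case by (intro exI[of _ "\<lambda>_. 1"]) auto
next
  case (insert i0 I)
  show ?case
  proof (cases "\<forall>j\<in>J. a i0 j = 0")
    case True
    have "card I < card J" using insert by simp
    then obtain c where "\<exists>j\<in>J. c j \<noteq> 0" "\<forall>i\<in>I. (\<Sum>j\<in>J. a i j * c j) = 0"
      using insert.IH[OF insert.prems(1)] by blast
    then show ?thesis using True by (intro exI[of _ c]) simp
  next
    case False
    then obtain j0 where j0: "j0 \<in> J" "a i0 j0 \<noteq> 0" by blast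
    let ?J = "J - {j0}"
    have "card I < card ?J" using insert j0 by simp
    then obtain c where c: "\<exists>j\<in>?J. c j \<noteq> 0"
      "\<forall>i\<in>I. (\<Sum>j\<in>?J. (a i j - a i j0 * a i0 j / a i0 j0) * c j) = 0"
      using insert.IH[of ?J "\<lambda>i j. a i j - a i j0 * a i0 j / a i0 j0"] insert.prems(1) by auto
    \<comment> \<open>Back-substitution: the value at \<open>j0\<close> is the one that solves
      equation \<open>i0\<close>.\<close>
    define c' where "c' = c(j0 := - (\<Sum>j\<in>?J. a i0 j * c j) / a i0 j0)"
    have split: "(\<Sum>j\<in>J. a i j * c' j) = a i j0 * c' j0 + (\<Sum>j\<in>?J. a i j * c j)" for i
    proof -
      have "(\<Sum>j\<in>J. a i j * c' j) = a i j0 * c' j0 + (\<Sum>j\<in>?J. a i j * c' j)"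
        using insert.prems(1) j0(1) by (rule sum.remove)
      also have "(\<Sum>j\<in>?J. a i j * c' j) = (\<Sum>j\<in>?J. a i j * c j)"
        by (rule sum.cong) (auto simp: c'_def)
      finally show ?thesis .
    qed
    have "(\<Sum>j\<in>J. a i0 j * c' j) = 0"
      unfolding split using j0(2) by (simp add: c'_def)
    moreover have "(\<Sum>j\<in>J. a i j * c' j) = 0" if "i \<in> I" for i
    proof -
      have "a i j0 * c' j0 = - (\<Sum>j\<in>?J. a i j0 * a i0 j / a i0 j0 * c j)"
        by (simp add: c'_def sum_distrib_left sum_divide_distrib mult.assoc)
      then show ?thesis
        unfolding split using c(2) that by (simp add: left_diff_distrib sum_subtractf)
    qed
    moreover have "\<exists>j\<in>J. c' j \<noteq> 0" using c(1) by (auto simp: c'_def)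
    ultimately show ?thesis by blast
  qed
qed

text \<open>Induction on the rows. Either row \<open>p\<close> already vanishes where the rows of
  \<open>P\<close> do and gets coefficient 0, or a suitable multiple of it is subtracted from
  \<open>f\<close>. It serves to solve Av = e_i.\<close>

lemma functional_in_row_space:
  fixes a :: "'b \<Rightarrow> nat \<Rightarrow> 'a::field"
  assumes "finite P"
    and "\<And>x. (\<forall>p\<in>P. (\<Sum>q<n. a p q * x q) = 0) \<Longrightarrow> (\<Sum>q<n. f q * x q) = 0"
  shows "\<exists>c. \<forall>q<n. f q = (\<Sum>p\<in>P. c p * a p q)"
  using assms
proof (induction P arbitrary: f rule: finite_induct)
  case empty
  have "f q = 0" if "q < n" for q
  proof -
    have "(\<Sum>q'<n. f q' * (if q' = q then 1 else 0)) = f q"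
      using that by (simp add: if_distrib cong: if_cong)
    then show ?thesis using empty[of "\<lambda>q'. if q' = q then 1 else 0"] by simp
  qed
  then show ?case by simp
next
  case (insert p P)
  show ?case
  proof (cases "\<exists>z. (\<forall>p'\<in>P. (\<Sum>q<n. a p' q * z q) = 0) \<and> (\<Sum>q<n. a p q * z q) \<noteq> 0")
    case False
    have "\<exists>c. \<forall>q<n. f q = (\<Sum>p'\<in>P. c p' * a p' q)"
    proof (rule insert.IH)
      fix x
      assume "\<forall>p'\<in>P. (\<Sum>q<n. a p' q * x q) = 0"
      then show "(\<Sum>q<n. f q * x q) = 0" using False insert.prems[of x] by blast
    qed
    then obtain c where c: "\<forall>q<n. f q = (\<Sum>p'\<in>P. c p' * a p' q)" by blast
    have "(\<Sum>p'\<in>P. (c(p := 0)) p' * a p' q) = (\<Sum>p'\<in>P. c p' * a p' q)" for q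
      using insert.hyps by (intro sum.cong) auto
    then show ?thesis
      using c insert.hyps by (intro exI[of _ "c(p := 0)"]) simp
  next
    case True
    then obtain z where z: "\<And>p'. p' \<in> P \<Longrightarrow> (\<Sum>q<n. a p' q * z q) = 0"
      "(\<Sum>q<n. a p q * z q) \<noteq> 0" by blast
    define s where "s = (\<Sum>q<n. a p q * z q)"
    \<comment> \<open>This choice makes f - t a_p vanish at \<open>z\<close>. Any \<open>x\<close>
      killed by the rows of \<open>P\<close> becomes a solution of row \<open>p\<close> too after
      subtracting \<open>u\<close> times \<open>z\<close>.\<close>
    define t where "t = (\<Sum>q<n. f q * z q) / s"
    have "(\<Sum>q<n. (f q - t * a p q) * x q) = 0"
      if x: "\<forall>p'\<in>P. (\<Sum>q<n. a p' q * x q) = 0" for x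
    proof -
      define u where "u = (\<Sum>q<n. a p q * x q) / s"
      have expand: "(\<Sum>q<n. g q * (x q - u * z q)) = (\<Sum>q<n. g q * x q) - u * (\<Sum>q<n. g q * z q)"
        for g :: "nat \<Rightarrow> 'a"
        by (simp add: sum_distrib_left sum_subtractf algebra_simps)
      have "(\<Sum>q<n. f q * (x q - u * z q)) = 0"
      proof (rule insert.prems)
        show "\<forall>p'\<in>insert p P. (\<Sum>q<n. a p' q * (x q - u * z q)) = 0"
          unfolding expand using x z by (auto simp: u_def s_def)
      qed
      then have "(\<Sum>q<n. f q * x q) = t * (\<Sum>q<n. a p q * x q)"
        unfolding expand using z(2) by (simp add: u_def t_def)
      then show ?thesis
        by (simp add: sum_distrib_left sum_subtractf algebra_simps)
    qed
    then obtain c where c: "\<forall>q<n. f q - t * a p q = (\<Sum>p'\<in>P. c p' * a p' q)"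
      using insert.IH[of "\<lambda>q. f q - t * a p q"] by auto
    have "(\<Sum>p'\<in>P. (c(p := t)) p' * a p' q) = (\<Sum>p'\<in>P. c p' * a p' q)" for q
      using insert.hyps by (intro sum.cong) auto
    then show ?thesis
      using c insert.hyps by (intro exI[of _ "c(p := t)"]) (simp add: diff_eq_eq add.commute)
  qed
qed

text \<open>A vector is a function of which only the values below the dimension matter.\<close>

definition mat_app :: "nat \<Rightarrow> real mat \<Rightarrow> (nat \<Rightarrow> real) \<Rightarrow> nat \<Rightarrow> real" where
  "mat_app n A x p = (\<Sum>q<n. A $$ (p, q) * x q)"

text \<open>Indexed families rather than sets, so that adjoining a vector is the update
  \<open>v(m := w)\<close>.\<close>

definition indep_family :: "nat \<Rightarrow> nat \<Rightarrow> (nat \<Rightarrow> nat \<Rightarrow> real) \<Rightarrow> bool" where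
  "indep_family n m v \<longleftrightarrow>
     (\<forall>c. (\<forall>p<n. (\<Sum>j<m. c j * v j p) = 0) \<longrightarrow> (\<forall>j<m. c j = 0))"

lemma indep_familyD:
  "indep_family n m v \<Longrightarrow> (\<And>p. p < n \<Longrightarrow> (\<Sum>j<m. c j * v j p) = 0) \<Longrightarrow> j < m \<Longrightarrow> c j = 0"
  unfolding indep_family_def by blast

lemma mat_app_cong:
  "(\<And>q. q < n \<Longrightarrow> x q = y q) \<Longrightarrow> mat_app n A x p = mat_app n A y p"
  unfolding mat_app_def by (intro sum.cong) auto

lemma mat_app_sum:
  "mat_app n A (\<lambda>q. \<Sum>j\<in>J. c j * v j q) p = (\<Sum>j\<in>J. c j * mat_app n A (v j) p)"
  unfolding mat_app_def sum_distrib_left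
  by (subst sum.swap) (simp add: mult.left_commute)

lemma mat_app_diff:
  "mat_app n A (\<lambda>q. x q - y q) p = mat_app n A x p - mat_app n A y p"
  unfolding mat_app_def by (simp add: right_diff_distrib sum_subtractf)

lemma mat_app_add:
  "mat_app n A (\<lambda>q. x q + y q) p = mat_app n A x p + mat_app n A y p"
  unfolding mat_app_def by (simp add: distrib_left sum.distrib)

lemma mat_app_scale:
  "mat_app n A (\<lambda>q. c * x q) p = c * mat_app n A x p"
  unfolding mat_app_def by (simp add: sum_distrib_left mult.left_commute)

text \<open>Steinitz bound: if k < m, the coefficients of the \<open>v j\<close> over the
  \<open>u s\<close> form a homogeneous system with a nontrivial solution, which is a dependence
  among the \<open>v j\<close>.\<close>

lemma indep_family_le_spanning:
  assumes indep: "indep_family n m v"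
    and span: "\<And>j. j < m \<Longrightarrow> \<exists>c. \<forall>p<n. v j p = (\<Sum>s<k. c s * u s p)"
  shows "m \<le> k"
proof (rule ccontr)
  assume "\<not> m \<le> k"
  then have "card {..<k} < card {..<m}" by simp
  from span obtain c where c: "\<And>j p. j < m \<Longrightarrow> p < n \<Longrightarrow> v j p = (\<Sum>s<k. c j s * u s p)"
    by metis
  obtain d where d: "\<exists>j<m. d j \<noteq> 0" "\<And>s. s < k \<Longrightarrow> (\<Sum>j<m. c j s * d j) = 0"
    using underdetermined_system[OF _ _ \<open>card {..<k} < card {..<m}\<close>, of "\<lambda>s j. c j s"] by auto
  have "(\<Sum>j<m. d j * v j p) = 0" if "p < n" for p
  proof -
    have "(\<Sum>j<m. d j * v j p) = (\<Sum>j<m. \<Sum>s<k. d j * (c j s * u s p))"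
      using c that by (simp add: sum_distrib_left)
    also have "\<dots> = (\<Sum>s<k. (\<Sum>j<m. c j s * d j) * u s p)"
      by (subst sum.swap) (simp add: sum_distrib_right mult.assoc mult.left_commute)
    also have "\<dots> = 0" using d(2) by simp
    finally show ?thesis .
  qed
  then show False using indep_familyD[OF indep] d(1) by blast
qed

lemma indep_family_le_dim:
  assumes "indep_family n m v"
  shows "m \<le> n"
proof (rule indep_family_le_spanning[OF assms])
  fix j
  show "\<exists>c. \<forall>p<n. v j p = (\<Sum>s<n. c s * (if s = p then 1 else 0))"
    by (intro exI[of _ "v j"]) (simp add: if_distrib cong: if_cong)
qed

lemma indep_family_Suc:
  assumes indep: "indep_family n m v"
    and new: "\<And>c. \<exists>p<n. w p \<noteq> (\<Sum>j<m. c j * v j p)"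
  shows "indep_family n (Suc m) (v(m := w))"
  unfolding indep_family_def
proof (intro allI impI)
  fix c j
  assume eq: "\<forall>p<n. (\<Sum>j<Suc m. c j * (v(m := w)) j p) = 0" and j: "j < Suc m"
  have eq': "(\<Sum>j<m. c j * v j p) + c m * w p = 0" if "p < n" for p
  proof -
    have "(\<Sum>j<m. c j * (v(m := w)) j p) = (\<Sum>j<m. c j * v j p)" by (intro sum.cong) auto
    then show ?thesis using eq that by simp
  qed
  have cm: "c m = 0"
  proof (rule ccontr)
    assume "c m \<noteq> 0"
    have "w p = (\<Sum>j<m. (- c j / c m) * v j p)" if "p < n" for p
    proof -
      have "(\<Sum>j<m. (- c j / c m) * v j p) = - (\<Sum>j<m. c j * v j p) / c m"
        by (simp add: sum_divide_distrib sum_negf)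
      moreover have "(\<Sum>j<m. c j * v j p) = - (c m * w p)" using eq'[OF that] by linarith
      ultimately show ?thesis using \<open>c m \<noteq> 0\<close> by simp
    qed
    then show False using new[of "\<lambda>j. - c j / c m"] by blast
  qed
  then have "c j = 0" if "j < m" for j
    using indep_familyD[OF indep _ that, of c] eq' by simp
  then show "c j = 0" using cm j by (cases "j = m") auto
qed

text \<open>Bridge from \<open>kernel_dim\<close> to coordinates: a library basis of the kernel,
  enumerated by a bijection \<open>h\<close>.\<close>

lemma kernel_basis_family:
  fixes A :: "real mat"
  assumes A: "A \<in> carrier_mat m n"
  obtains v where "indep_family n (kernel_dim A) v"
    and "\<And>j p. j < kernel_dim A \<Longrightarrow> p < m \<Longrightarrow> mat_app n A (v j) p = 0"
    and "\<And>x. (\<And>p. p < m \<Longrightarrow> mat_app n A x p = 0) \<Longrightarrow>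
      \<exists>c. \<forall>q<n. x q = (\<Sum>j<kernel_dim A. c j * v j q)"
proof -
  interpret kernel m n A by unfold_locales (rule A)
  obtain B where B: "finite B" "basis B" using kernel_basis_exists[OF A] by auto
  have sub: "B \<subseteq> mat_kernel A" and gen: "span B = mat_kernel A" and ind: "lin_indpt B"
    using B(2) unfolding Ker.basis_def by auto
  have card: "card B = kernel_dim A" using Ker.dim_basis[OF B] by simp
  obtain h where h: "bij_betw h {..<kernel_dim A} B"
    using ex_bij_betw_nat_finite[OF B(1)] card by (auto simp: lessThan_atLeast0)
  have app: "mat_app n A (($) x) p = (A *\<^sub>v x) $ p" if "x \<in> carrier_vec n" "p < m" for x p
    using A that by (auto simp: mat_app_def scalar_prod_def lessThan_atLeast0 intro!: sum.cong)
  have reindex: "(\<Sum>b\<in>B. c b * b $ q) = (\<Sum>j<kernel_dim A. c (h j) * h j $ q)" for c q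
    using sum.reindex_bij_betw[OF h, of "\<lambda>b. c b * b $ q"] by simp
  show thesis
  proof (rule that[of "\<lambda>j. ($) (h j)"])
    show "indep_family n (kernel_dim A) (\<lambda>j. ($) (h j))"
      unfolding indep_family_def
    proof (intro allI impI)
      fix c j
      assume c: "\<forall>p<n. (\<Sum>j<kernel_dim A. c j * h j $ p) = 0" and j: "j < kernel_dim A"
      let ?c = "\<lambda>b. c (the_inv_into {..<kernel_dim A} h b)"
      have inv: "?c (h j) = c j" if "j < kernel_dim A" for j
        using h that by (simp add: bij_betw_def the_inv_into_f_f)
      have "lincomb ?c B = 0\<^sub>v n"
      proof (rule eq_vecI)
        fix q
        assume "q < dim_vec (0\<^sub>v n :: real vec)"
        then have q: "q < n" by simp
        have "lincomb ?c B $ q = (\<Sum>j<kernel_dim A. ?c (h j) * h j $ q)"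
          using lincomb_index[OF q sub, of ?c] unfolding reindex .
        also have "\<dots> = (\<Sum>j<kernel_dim A. c j * h j $ q)" using inv by (intro sum.cong) auto
        finally show "lincomb ?c B $ q = 0\<^sub>v n $ q" using c q by simp
      next
        have "lincomb ?c B \<in> mat_kernel A" using sub by (intro Ker.lincomb_closed) auto
        then show "dim_vec (lincomb ?c B) = dim_vec (0\<^sub>v n)" using mat_kernelD(1)[OF A] by auto
      qed
      moreover have "h j \<in> B" using h j by (auto simp: bij_betw_def)
      ultimately have "?c (h j) = 0"
        using ind B(1) unfolding Ker.lin_dep_def by auto
      then show "c j = 0" using inv[OF j] by simp
    qed
  next
    fix j p
    assume "j < kernel_dim A" and p: "p < m"
    then have "h j \<in> mat_kernel A" using h sub by (auto simp: bij_betw_def)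
    then show "mat_app n A (($) (h j)) p = 0"
      using app[OF _ p] mat_kernelD[OF A] p by simp
  next
    fix x
    assume x: "\<And>p. p < m \<Longrightarrow> mat_app n A x p = 0"
    have "A *\<^sub>v vec n x = 0\<^sub>v m"
    proof (rule eq_vecI)
      fix p
      assume "p < dim_vec (0\<^sub>v m :: real vec)"
      then have p: "p < m" by simp
      have "(A *\<^sub>v vec n x) $ p = mat_app n A (($) (vec n x)) p" using app[OF _ p] by simp
      also have "\<dots> = mat_app n A x p" by (rule mat_app_cong) simp
      finally show "(A *\<^sub>v vec n x) $ p = 0\<^sub>v m $ p" using x p by simp
    qed (use A in auto)
    then have "vec n x \<in> span B" unfolding gen by (intro mat_kernelI[OF A]) auto
    then obtain a where a: "vec n x = lincomb a B"
      using Ker.finite_in_span[OF B(1)] sub by metis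
    have "x q = (\<Sum>j<kernel_dim A. a (h j) * h j $ q)" if q: "q < n" for q
      using lincomb_index[OF q sub, of a] q unfolding a[symmetric] reindex by simp
    then show "\<exists>c. \<forall>q<n. x q = (\<Sum>j<kernel_dim A. c j * h j $ q)"
      by (intro exI[of _ "\<lambda>j. a (h j)"]) blast
  qed
qed

lemma indep_family_le_kernel_dim:
  assumes "A \<in> carrier_mat m n" and "indep_family n k v"
    and "\<And>j p. j < k \<Longrightarrow> p < m \<Longrightarrow> mat_app n A (v j) p = 0"
  shows "k \<le> kernel_dim A"
proof -
  obtain u where "\<And>x. (\<And>p. p < m \<Longrightarrow> mat_app n A x p = 0) \<Longrightarrow>
      \<exists>c. \<forall>q<n. x q = (\<Sum>j<kernel_dim A. c j * u j q)"
    by (rule kernel_basis_family[OF assms(1)]) blast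
  then show ?thesis
    using assms(3) by (intro indep_family_le_spanning[OF assms(2), where u = u]) simp
qed

section \<open>The kernel with the root equation removed\<close>

text \<open>Membership in the space W. The SNIP condition on the matrix with row \<open>i\<close>
  deleted says that every column of X lies in W.\<close>

definition null_off_root :: "nat \<Rightarrow> real mat \<Rightarrow> nat \<Rightarrow> (nat \<Rightarrow> real) \<Rightarrow> bool" where
  "null_off_root n A i x \<longleftrightarrow> (\<forall>p<n. p \<noteq> i \<longrightarrow> mat_app n A x p = 0)"

text \<open>Padding a vector with 0 at \<open>i\<close> turns the equations of A(i) into the
  equations of A off row \<open>i\<close>. Hence the kernel of A(i) is a copy of the subspace of W
  cut out by x_i = 0.\<close>

lemma deleted_kernel_basis_family:
  fixes A :: "real mat"
  assumes A: "A \<in> carrier_mat n n" and i: "i < n"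
  defines "l \<equiv> kernel_dim (mat_delete A i i)"
  obtains u where "indep_family n l u"
    and "\<And>j. j < l \<Longrightarrow> u j i = 0"
    and "\<And>j. j < l \<Longrightarrow> null_off_root n A i (u j)"
    and "\<And>x. null_off_root n A i x \<Longrightarrow> x i = 0 \<Longrightarrow>
      \<exists>c. \<forall>q<n. x q = (\<Sum>j<l. c j * u j q)"
proof -
  let ?D = "mat_delete A i i" and ?s = "insert_index i"
  define lift where "lift y q = (if q = i then 0 else y (delete_index i q))"
    for y :: "nat \<Rightarrow> real" and q
  have bij: "bij_betw ?s {..<n - 1} ({..<n} - {i})"
    by (rule bij_betw_byWitness[where f' = "delete_index i"])
      (use i in \<open>auto simp: insert_index_def delete_index_def\<close>)
  have lift_s: "lift y (?s q) = y q" for y q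
    by (simp add: lift_def insert_index_def delete_index_def)
  have reach: "\<exists>p'<n - 1. p = ?s p'" if "p < n" "p \<noteq> i" for p
    using that i by (intro exI[of _ "delete_index i p"]) (auto simp: insert_index_def delete_index_def)
  have s_less: "?s p < n" "?s p \<noteq> i" if "p < n - 1" for p
    using that by (auto simp: insert_index_def)
  have D: "?D \<in> carrier_mat (n - 1) (n - 1)" using A by (rule mat_delete_carrier)
  have app: "mat_app (n - 1) ?D (\<lambda>q. x (?s q)) p = mat_app n A x (?s p)"
    if "p < n - 1" "x i = 0" for p x
  proof -
    have "mat_app n A x (?s p) = (\<Sum>q\<in>{..<n} - {i}. A $$ (?s p, q) * x q)"
      unfolding mat_app_def using that i by (subst sum.remove[of _ i]) auto
    also have "\<dots> = (\<Sum>q<n - 1. A $$ (?s p, ?s q) * x (?s q))"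
      using sum.reindex_bij_betw[OF bij, of "\<lambda>q. A $$ (?s p, q) * x q"] by simp
    also have "\<dots> = mat_app (n - 1) ?D (\<lambda>q. x (?s q)) p"
      unfolding mat_app_def using A that
      by (intro sum.cong) (auto simp: mat_delete_def insert_index_def)
    finally show ?thesis by simp
  qed
  obtain v where v: "indep_family (n - 1) l v"
    "\<And>j p. j < l \<Longrightarrow> p < n - 1 \<Longrightarrow> mat_app (n - 1) ?D (v j) p = 0"
    "\<And>x. (\<And>p. p < n - 1 \<Longrightarrow> mat_app (n - 1) ?D x p = 0) \<Longrightarrow>
      \<exists>c. \<forall>q<n - 1. x q = (\<Sum>j<l. c j * v j q)"
    by (rule kernel_basis_family[OF D, folded l_def]) blast
  show thesis
  proof (rule that[of "\<lambda>j. lift (v j)"])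
    show "indep_family n l (\<lambda>j. lift (v j))"
      unfolding indep_family_def
    proof (intro allI impI)
      fix c j
      assume c: "\<forall>p<n. (\<Sum>j<l. c j * lift (v j) p) = 0" and j: "j < l"
      show "c j = 0"
      proof (rule indep_familyD[OF v(1) _ j])
        fix p
        assume "p < n - 1"
        then show "(\<Sum>j<l. c j * v j p) = 0"
          using c[rule_format, OF s_less(1)[of p]] unfolding lift_s by simp
      qed
    qed
    show "lift (v j) i = 0" for j by (simp add: lift_def)
    show "null_off_root n A i (lift (v j))" if j: "j < l" for j
      unfolding null_off_root_def
    proof (intro allI impI)
      fix p
      assume "p < n" "p \<noteq> i"
      then obtain p' where p': "p' < n - 1" "p = ?s p'" using reach by blast
      have "mat_app n A (lift (v j)) p = mat_app (n - 1) ?D (v j) p'"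
        using app[OF p'(1), of "lift (v j)"] p'(2) lift_s by (simp add: lift_def[of _ i])
      then show "mat_app n A (lift (v j)) p = 0" using v(2)[OF j p'(1)] by simp
    qed
    show "\<exists>c. \<forall>q<n. x q = (\<Sum>j<l. c j * lift (v j) q)"
      if x: "null_off_root n A i x" "x i = 0" for x
    proof -
      have "\<exists>c. \<forall>q<n - 1. x (?s q) = (\<Sum>j<l. c j * v j q)"
        using app x s_less by (intro v(3)) (simp add: null_off_root_def)
      then obtain c where c: "\<And>q. q < n - 1 \<Longrightarrow> x (?s q) = (\<Sum>j<l. c j * v j q)" by blast
      have "x q = (\<Sum>j<l. c j * lift (v j) q)" if "q < n" for q
      proof (cases "q = i")
        case True
        then show ?thesis using x(2) by (simp add: lift_def)
      next
        case False
        then obtain q' where "q' < n - 1" "q = ?s q'" using reach \<open>q < n\<close> by blast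
        then show ?thesis using c lift_s by simp
      qed
      then show ?thesis by (intro exI[of _ c]) simp
    qed
  qed
qed

lemma mat_app_symmetric:
  assumes "\<And>p q. p < n \<Longrightarrow> q < n \<Longrightarrow> A $$ (p, q) = A $$ (q, p)"
  shows "(\<Sum>p<n. y p * mat_app n A x p) = (\<Sum>p<n. x p * mat_app n A y p)"
proof -
  have "(\<Sum>p<n. y p * mat_app n A x p) = (\<Sum>p<n. \<Sum>q<n. y p * (A $$ (p, q) * x q))"
    by (simp add: mat_app_def sum_distrib_left)
  also have "\<dots> = (\<Sum>q<n. \<Sum>p<n. y p * (A $$ (p, q) * x q))" by (rule sum.swap)
  also have "\<dots> = (\<Sum>q<n. \<Sum>p<n. x q * (A $$ (q, p) * y p))"
    using assms by (intro sum.cong) auto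
  finally show ?thesis by (simp add: mat_app_def sum_distrib_left)
qed

text \<open>With \<open>mat_app_symmetric\<close> this gives w_i (Au)_i = u_i (Aw)_i for u and w in
  W.\<close>

lemma sum_mat_app_null_off_root:
  assumes "null_off_root n A i x" "i < n"
  shows "(\<Sum>p<n. y p * mat_app n A x p) = y i * mat_app n A x i"
proof -
  have "(\<Sum>p\<in>{..<n} - {i}. y p * mat_app n A x p) = 0"
    using assms(1) by (intro sum.neutral) (simp add: null_off_root_def)
  then show ?thesis using assms(2) by (subst sum.remove[of _ i]) auto
qed

lemma sym_matsD:
  assumes "A \<in> sym_mats n"
  shows "A \<in> carrier_mat n n" "p < n \<Longrightarrow> q < n \<Longrightarrow> A $$ (p, q) = A $$ (q, p)"
proof -
  show A: "A \<in> carrier_mat n n" using assms by (simp add: sym_mats_def)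
  show "A $$ (p, q) = A $$ (q, p)" if "p < n" "q < n"
    using assms A that index_transpose_mat(1)[of q A p] by (simp add: sym_mats_def)
qed

text \<open>If some w in W has w_i nonzero, symmetry puts every u in W with u_i = 0 into the kernel
  of A, so l \<le> k, and w adds one dimension. Otherwise W is the padded kernel of A(i), of
  dimension l, and also the kernel of A plus a solution of Av = e_i, of dimension k + 1.\<close>

lemma nullity_pair_cases:
  fixes A :: "real mat"
  assumes A: "A \<in> sym_mats n" and i: "i < n"
    and kl: "nullity_pair A i = (k, l)" "k \<le> l"
  obtains (root_free) v w where "k = l"
      and "indep_family n (l + 1) v" and "\<And>j. j < l + 1 \<Longrightarrow> null_off_root n A i (v j)"
      and "null_off_root n A i w" and "w i \<noteq> 0"
    | (root_zero) v where "l = k + 1"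
      and "indep_family n l v" and "\<And>j. j < l \<Longrightarrow> null_off_root n A i (v j)"
      and "\<And>x. null_off_root n A i x \<Longrightarrow> x i = 0"
proof -
  have carrier: "A \<in> carrier_mat n n" using sym_matsD[OF A] by simp
  have k: "k = kernel_dim A" and l: "l = kernel_dim (mat_delete A i i)"
    using kl by (auto simp: nullity_pair_def)
  obtain u where u: "indep_family n l u"
    "\<And>j. j < l \<Longrightarrow> u j i = 0" "\<And>j. j < l \<Longrightarrow> null_off_root n A i (u j)"
    "\<And>x. null_off_root n A i x \<Longrightarrow> x i = 0 \<Longrightarrow> \<exists>c. \<forall>q<n. x q = (\<Sum>j<l. c j * u j q)"
    by (rule deleted_kernel_basis_family[OF carrier i, folded l]) blast
  show thesis
  proof (cases "\<exists>w. null_off_root n A i w \<and> w i \<noteq> 0")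
    case True
    then obtain w where w: "null_off_root n A i w" "w i \<noteq> 0" by blast
    have "mat_app n A (u j) p = 0" if j: "j < l" and p: "p < n" for j p
    proof (cases "p = i")
      case True
      have "w i * mat_app n A (u j) i = u j i * mat_app n A w i"
        using mat_app_symmetric[of n A w "u j"] sym_matsD(2)[OF A]
          sum_mat_app_null_off_root[OF u(3)[OF j] i, of w] sum_mat_app_null_off_root[OF w(1) i, of "u j"]
        by simp
      then show ?thesis using w(2) u(2)[OF j] True by simp
    next
      case False
      then show ?thesis using u(3)[OF j] p by (simp add: null_off_root_def)
    qed
    then have "l \<le> k" unfolding k by (intro indep_family_le_kernel_dim[OF carrier u(1)])
    moreover have "indep_family n (Suc l) (u(l := w))"
      using u(2) w(2) i by (intro indep_family_Suc[OF u(1)]) (auto intro!: exI[of _ i])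
    moreover have "null_off_root n A i ((u(l := w)) j)" if "j < l + 1" for j
      using that u(3) w(1) by (cases "j = l") auto
    ultimately show thesis using root_free[of "u(l := w)" w] w kl(2) by simp
  next
    case False
    \<comment> \<open>The functional x_i vanishes on W, so e_i is a combination of the rows other
      than \<open>i\<close>; by symmetry of A its coefficients solve Av = e_i.\<close>
    have "\<exists>c. \<forall>q<n. (if q = i then 1 else 0) = (\<Sum>p\<in>{..<n} - {i}. c p * A $$ (p, q))"
    proof (rule functional_in_row_space)
      fix x
      assume "\<forall>p\<in>{..<n} - {i}. (\<Sum>q<n. A $$ (p, q) * x q) = 0"
      then have "null_off_root n A i x" by (simp add: null_off_root_def mat_app_def)
      then have "x i = 0" using False by blast
      then show "(\<Sum>q<n. (if q = i then 1 else 0) * x q) = 0"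
        by (intro sum.neutral) auto
    qed simp
    then obtain c where c:
      "\<And>q. q < n \<Longrightarrow> (if q = i then 1 else 0) = (\<Sum>p\<in>{..<n} - {i}. c p * A $$ (p, q))"
      by blast
    \<comment> \<open>The combination leaves \<open>c i\<close> free, whereas \<open>mat_app\<close>
      sums over \<open>i\<close> as well.\<close>
    define v where "v = c(i := 0)"
    have Av: "mat_app n A v q = (if q = i then 1 else 0)" if q: "q < n" for q
    proof -
      have "mat_app n A v q = (\<Sum>p\<in>{..<n} - {i}. A $$ (q, p) * v p)"
        unfolding mat_app_def using i by (subst sum.remove[of _ i]) (auto simp: v_def)
      also have "\<dots> = (\<Sum>p\<in>{..<n} - {i}. c p * A $$ (p, q))"
        using sym_matsD(2)[OF A q] by (intro sum.cong) (auto simp: v_def)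
      finally show ?thesis using c[OF q] by simp
    qed
    then have v: "null_off_root n A i v" by (simp add: null_off_root_def)
    obtain z where z: "indep_family n k z"
      "\<And>j p. j < k \<Longrightarrow> p < n \<Longrightarrow> mat_app n A (z j) p = 0"
      "\<And>x. (\<And>p. p < n \<Longrightarrow> mat_app n A x p = 0) \<Longrightarrow> \<exists>c. \<forall>q<n. x q = (\<Sum>j<k. c j * z j q)"
      by (rule kernel_basis_family[OF carrier, folded k]) blast
    have indep: "indep_family n (Suc k) (z(k := v))"
    proof (rule indep_family_Suc[OF z(1)], rule ccontr)
      fix c
      assume "\<not> (\<exists>p<n. v p \<noteq> (\<Sum>j<k. c j * z j p))"
      then have "mat_app n A v i = mat_app n A (\<lambda>p. \<Sum>j<k. c j * z j p) i"
        by (intro mat_app_cong) blast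
      also have "\<dots> = 0" using z(2)[OF _ i] by (simp add: mat_app_sum)
      finally show False using Av[OF i] by simp
    qed
    have "Suc k \<le> l"
    proof (rule indep_family_le_spanning[OF indep])
      fix j
      assume "j < Suc k"
      then have "null_off_root n A i ((z(k := v)) j)"
        using z(2) v by (auto simp: null_off_root_def less_Suc_eq)
      then show "\<exists>c. \<forall>p<n. (z(k := v)) j p = (\<Sum>s<l. c s * u s p)" using u(4) False by blast
    qed
    moreover have "l \<le> Suc k"
    proof (rule indep_family_le_spanning[OF u(1)])
      fix j
      assume j: "j < l"
      \<comment> \<open>Since Av = e_i, subtracting \<open>t\<close> times \<open>v\<close> also
        clears row \<open>i\<close> and lands in the kernel of A.\<close>
      define t where "t = mat_app n A (u j) i"
      have "\<exists>c. \<forall>q<n. u j q - t * v q = (\<Sum>j<k. c j * z j q)"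
        using u(3)[OF j] Av
        by (intro z(3)) (simp add: mat_app_diff mat_app_scale t_def null_off_root_def)
      then obtain c where c: "\<And>q. q < n \<Longrightarrow> u j q - t * v q = (\<Sum>j<k. c j * z j q)" by blast
      have "u j q = (\<Sum>s<Suc k. (c(k := t)) s * (z(k := v)) s q)" if "q < n" for q
      proof -
        have "(\<Sum>s<k. (c(k := t)) s * (z(k := v)) s q) = (\<Sum>s<k. c s * z s q)"
          by (intro sum.cong) auto
        then show ?thesis using c[OF that] by simp
      qed
      then show "\<exists>c. \<forall>q<n. u j q = (\<Sum>s<Suc k. c s * (z(k := v)) s q)" by blast
    qed
    ultimately show thesis using root_zero[of u] u(1,3) False by simp
  qed
qed

section \<open>Counting the entries of symmetric products\<close>

text \<open>These pairs index the symmetrized products of the vectors \<open>v s\<close> and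
  \<open>v t\<close>.\<close>

lemma card_lower_triangle: "card (SIGMA s:{..<N}. {..s}) = (N + 1) choose 2"
proof -
  have "(\<Sum>s<N. Suc s) = (N + 1) choose 2"
    by (induction N) (simp_all add: numeral_2_eq_2)
  then show ?thesis by simp
qed

text \<open>With the \<open>v s\<close> as columns of V, the matrices V C V^T with C symmetric have
  dimension \<open>(N + 1) choose 2\<close>, so fewer prescribed zeros leave a nonzero one.
  \<open>D\<close> exhibits its columns as combinations of the \<open>v s\<close>.\<close>

lemma symmetric_product_with_zeros:
  fixes v :: "nat \<Rightarrow> nat \<Rightarrow> real" and a b :: "'b \<Rightarrow> nat"
  assumes indep: "indep_family n N v" and Z: "finite Z" "card Z < (N + 1) choose 2"
  obtains X D where "\<And>p q. X p q = X q p"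
    and "\<And>p q. X p q = (\<Sum>s<N. D s q * v s p)"
    and "\<And>z. z \<in> Z \<Longrightarrow> X (a z) (b z) = 0"
    and "\<exists>p<n. \<exists>q<n. X p q \<noteq> 0"
proof -
  define P where "P = (SIGMA s:{..<N}. {..s})"
  define B where "B st p q = v (fst st) p * v (snd st) q + v (snd st) p * v (fst st) q"
    for st p q
  have "finite P" "card Z < card P"
    using Z(2) card_lower_triangle[of N] by (auto simp: P_def)
  from underdetermined_system[OF Z(1) this, of "\<lambda>z st. B st (a z) (b z)"]
  obtain c where c: "\<exists>st\<in>P. c st \<noteq> 0"
    "\<And>z. z \<in> Z \<Longrightarrow> (\<Sum>st\<in>P. B st (a z) (b z) * c st) = 0" by blast
  define X where "X p q = (\<Sum>st\<in>P. B st p q * c st)" for p q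
  \<comment> \<open>The symmetric matrix with X = V C V^T. On the diagonal both summands count,
    matching the doubled product in \<open>B\<close>.\<close>
  define C where "C s t = (if t \<le> s then c (s, t) else 0) + (if s \<le> t then c (t, s) else 0)" for s t
  define D where "D s q = (\<Sum>t<N. C s t * v t q)" for s q
  have sumP: "(\<Sum>st\<in>P. c st * f (fst st) (snd st)) =
      (\<Sum>s<N. \<Sum>t<N. (if t \<le> s then c (s, t) else 0) * f s t)" for f :: "nat \<Rightarrow> nat \<Rightarrow> real"
  proof -
    have "(\<Sum>st\<in>P. c st * f (fst st) (snd st)) = (\<Sum>s<N. \<Sum>t\<in>{..s}. c (s, t) * f s t)"
      unfolding P_def by (subst sum.Sigma) (auto intro!: sum.cong)
    also have "\<dots> = (\<Sum>s<N. \<Sum>t<N. (if t \<le> s then c (s, t) else 0) * f s t)"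
    proof (rule sum.cong[OF refl])
      fix s
      assume "s \<in> {..<N}"
      then show "(\<Sum>t\<in>{..s}. c (s, t) * f s t) = (\<Sum>t<N. (if t \<le> s then c (s, t) else 0) * f s t)"
        by (intro sum.mono_neutral_cong_left) auto
    qed
    finally show ?thesis .
  qed
  have X_D: "X p q = (\<Sum>s<N. D s q * v s p)" for p q
  proof -
    have "X p q = (\<Sum>st\<in>P. c st * (v (fst st) p * v (snd st) q))
        + (\<Sum>st\<in>P. c st * (v (snd st) p * v (fst st) q))"
      by (simp add: X_def B_def algebra_simps sum.distrib)
    also have "(\<Sum>st\<in>P. c st * (v (fst st) p * v (snd st) q)) =
        (\<Sum>s<N. \<Sum>t<N. (if t \<le> s then c (s, t) else 0) * (v s p * v t q))"
      by (rule sumP[of "\<lambda>s t. v s p * v t q"])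
    also have "(\<Sum>st\<in>P. c st * (v (snd st) p * v (fst st) q)) =
        (\<Sum>s<N. \<Sum>t<N. (if s \<le> t then c (t, s) else 0) * (v s p * v t q))"
      unfolding sumP[of "\<lambda>s t. v t p * v s q"] by (rule sum.swap)
    also have "(\<Sum>s<N. \<Sum>t<N. (if t \<le> s then c (s, t) else 0) * (v s p * v t q))
        + (\<Sum>s<N. \<Sum>t<N. (if s \<le> t then c (t, s) else 0) * (v s p * v t q))
        = (\<Sum>s<N. \<Sum>t<N. C s t * (v s p * v t q))"
      by (simp only: C_def distrib_right sum.distrib)
    also have "\<dots> = (\<Sum>s<N. D s q * v s p)"
      unfolding D_def sum_distrib_right by (intro sum.cong refl) simp
    finally show ?thesis .
  qed
  show thesis
  proof (rule that[of X D])
    show "X p q = X q p" for p q by (simp add: X_def B_def mult.commute add.commute)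
    show "X p q = (\<Sum>s<N. D s q * v s p)" for p q by (rule X_D)
    show "X (a z) (b z) = 0" if "z \<in> Z" for z using c(2)[OF that] by (simp add: X_def)
    show "\<exists>p<n. \<exists>q<n. X p q \<noteq> 0"
    proof (rule ccontr)
      assume "\<not> ?thesis"
      \<comment> \<open>Independence is used twice: X = 0 forces \<open>D\<close> = 0 column by
        column, and then \<open>C\<close> = 0 row by row.\<close>
      then have "D s q = 0" if "s < N" "q < n" for s q
        using that X_D by (intro indep_familyD[OF indep _ that(1), of "\<lambda>s. D s q"]) auto
      then have C0: "C s t = 0" if "s < N" "t < N" for s t
        using that by (intro indep_familyD[OF indep _ that(2), of "C s"]) (simp add: D_def)
      obtain s t where "t \<le> s" "s < N" "c (s, t) \<noteq> 0" using c(1) by (auto simp: P_def)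
      then show False using C0[of s t] by (cases "s = t") (auto simp: C_def)
    qed
  qed
qed

section \<open>The edge bound\<close>

lemma SNIP_conditions_iff:
  assumes A: "A \<in> carrier_mat n n" and M: "M \<in> carrier_mat n n" and i: "i < n"
  shows "hadamard_mat A M = 0\<^sub>m n n \<longleftrightarrow> (\<forall>p<n. \<forall>q<n. A $$ (p, q) \<noteq> 0 \<longrightarrow> M $$ (p, q) = 0)"
    and "hadamard_mat (1\<^sub>m n) M = 0\<^sub>m n n \<longleftrightarrow> (\<forall>p<n. M $$ (p, p) = 0)"
    and "del_row (A * M) i = 0\<^sub>m (n - 1) n \<longleftrightarrow> (\<forall>q<n. null_off_root n A i (\<lambda>p. M $$ (p, q)))"
proof -
  show "hadamard_mat A M = 0\<^sub>m n n \<longleftrightarrow> (\<forall>p<n. \<forall>q<n. A $$ (p, q) \<noteq> 0 \<longrightarrow> M $$ (p, q) = 0)"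
    using A M by (auto simp: hadamard_mat_def mat_eq_iff)
  show "hadamard_mat (1\<^sub>m n) M = 0\<^sub>m n n \<longleftrightarrow> (\<forall>p<n. M $$ (p, p) = 0)"
    using M by (auto simp: hadamard_mat_def mat_eq_iff)
  have prod: "(A * M) $$ (p, q) = mat_app n A (\<lambda>p. M $$ (p, q)) p" if "p < n" "q < n" for p q
    using A M that
    by (auto simp: mat_app_def scalar_prod_def lessThan_atLeast0 intro!: sum.cong)
  have reach: "(\<forall>p'<n - 1. Q (if p' < i then p' else Suc p')) \<longleftrightarrow> (\<forall>p<n. p \<noteq> i \<longrightarrow> Q p)"
    for Q :: "nat \<Rightarrow> bool"
  proof (intro iffI allI impI)
    fix p
    assume Q: "\<forall>p'<n - 1. Q (if p' < i then p' else Suc p')" and p: "p < n" "p \<noteq> i"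
    show "Q p"
    proof (cases "p < i")
      case True
      then show ?thesis using Q[rule_format, of p] i by simp
    next
      case False
      then have "\<not> p - 1 < i" "Suc (p - 1) = p" "p - 1 < n - 1" using p by auto
      then show ?thesis using Q[rule_format, of "p - 1"] by simp
    qed
  qed auto
  have "del_row (A * M) i = 0\<^sub>m (n - 1) n \<longleftrightarrow>
      (\<forall>p'<n - 1. \<forall>q<n. (A * M) $$ (if p' < i then p' else Suc p', q) = 0)"
    using A M by (auto simp: del_row_def mat_eq_iff)
  also have "\<dots> \<longleftrightarrow> (\<forall>p<n. p \<noteq> i \<longrightarrow> (\<forall>q<n. (A * M) $$ (p, q) = 0))"
    by (rule reach)
  also have "\<dots> \<longleftrightarrow> (\<forall>q<n. null_off_root n A i (\<lambda>p. M $$ (p, q)))"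
    using prod by (auto simp: null_off_root_def)
  finally show "del_row (A * M) i = 0\<^sub>m (n - 1) n \<longleftrightarrow>
      (\<forall>q<n. null_off_root n A i (\<lambda>p. M $$ (p, q)))" .
qed

lemma has_SNIPD:
  fixes X :: "nat \<Rightarrow> nat \<Rightarrow> real"
  assumes snip: "has_SNIP n A i" and i: "i < n"
    and X: "\<And>p q. X p q = X q p" "\<And>p. p < n \<Longrightarrow> X p p = 0"
      "\<And>p q. p < n \<Longrightarrow> q < n \<Longrightarrow> A $$ (p, q) \<noteq> 0 \<Longrightarrow> X p q = 0"
      "\<And>q. q < n \<Longrightarrow> null_off_root n A i (\<lambda>p. X p q)"
    and pq: "p < n" "q < n"
  shows "X p q = 0"
proof -
  define M where "M = mat n n (\<lambda>(p, q). X p q)"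
  have A: "A \<in> carrier_mat n n" using snip by (simp add: has_SNIP_def sym_matsD(1))
  have M: "M \<in> carrier_mat n n" "M \<in> sym_mats n"
    using X(1) by (auto simp: M_def sym_mats_def)
  have "null_off_root n A i (\<lambda>p. M $$ (p, q))" if "q < n" for q
    unfolding null_off_root_def
  proof (intro allI impI)
    fix p
    assume "p < n" "p \<noteq> i"
    have "mat_app n A (\<lambda>p. M $$ (p, q)) p = mat_app n A (\<lambda>p. X p q) p"
      by (rule mat_app_cong) (simp add: M_def that)
    then show "mat_app n A (\<lambda>p. M $$ (p, q)) p = 0"
      using X(4)[OF that] \<open>p < n\<close> \<open>p \<noteq> i\<close> by (simp add: null_off_root_def)
  qed
  moreover have "\<forall>p<n. \<forall>q<n. A $$ (p, q) \<noteq> 0 \<longrightarrow> M $$ (p, q) = 0" "\<forall>p<n. M $$ (p, p) = 0"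
    using X(2,3) by (auto simp: M_def)
  ultimately have "M = 0\<^sub>m n n"
    using snip M(2) SNIP_conditions_iff[OF A M(1) i] unfolding has_SNIP_def by blast
  then have "M $$ (p, q) = 0" using pq by simp
  then show ?thesis using pq by (simp add: M_def)
qed

text \<open>Breadth-first tree: \<open>d\<close> is the distance from \<open>r\<close>, and the
  parent is the predecessor on a shortest path.\<close>

lemma rtrancl_parent:
  obtains d :: "'a \<Rightarrow> nat" and parent where
    "\<And>p. (r, p) \<in> R\<^sup>* \<Longrightarrow> p \<noteq> r \<Longrightarrow>
      (r, parent p) \<in> R\<^sup>* \<and> (parent p, p) \<in> R \<and> d (parent p) < d p"
proof -
  define d where "d p = (LEAST m. (r, p) \<in> R ^^ m)" for p
  have "\<exists>q. (r, q) \<in> R\<^sup>* \<and> (q, p) \<in> R \<and> d q < d p" if "(r, p) \<in> R\<^sup>*" "p \<noteq> r" for p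
  proof -
    have "\<exists>m. (r, p) \<in> R ^^ m" using that(1) by (simp add: rtrancl_is_UN_relpow)
    then have dp: "(r, p) \<in> R ^^ d p" unfolding d_def by (rule LeastI_ex)
    with that(2) obtain m where m: "d p = Suc m" by (cases "d p") auto
    with dp obtain q where q: "(r, q) \<in> R ^^ m" "(q, p) \<in> R" by auto
    have "d q \<le> m" unfolding d_def using q(1) by (rule Least_le)
    then show ?thesis using q m by (auto intro: relpow_imp_rtrancl)
  qed
  then obtain parent where "\<And>p. (r, p) \<in> R\<^sup>* \<Longrightarrow> p \<noteq> r \<Longrightarrow>
      (r, parent p) \<in> R\<^sup>* \<and> (parent p, p) \<in> R \<and> d (parent p) < d p" by metis
  then show thesis by (rule that)
qed

text \<open>If \<open>s\<close> lay outside the component R of \<open>r\<close>, cutting vectors of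
  W along R would keep them in W and yield a nonzero X against the SNIP. The set \<open>U\<close>
  allows the root to be left out when W vanishes there.\<close>

lemma SNIP_support_connected:
  assumes snip: "has_SNIP n A i" and i: "i < n"
    and U: "{..<n} - {i} \<subseteq> U" "U \<subseteq> {..<n}"
      "\<And>x q. null_off_root n A i x \<Longrightarrow> q < n \<Longrightarrow> q \<notin> U \<Longrightarrow> x q = 0"
    and w: "null_off_root n A i w" "w r \<noteq> 0" "r < n"
    and x: "null_off_root n A i x" "x s \<noteq> 0" "s < n"
  shows "(r, s) \<in> {(p, q). p \<in> U \<and> q \<in> U \<and> A $$ (p, q) \<noteq> 0}\<^sup>*" (is "_ \<in> ?rel\<^sup>*")
proof (rule ccontr)
  assume rs: "(r, s) \<notin> ?rel\<^sup>*"
  define R where "R = {p. (r, p) \<in> ?rel\<^sup>*}"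
  have sym: "\<And>p q. p < n \<Longrightarrow> q < n \<Longrightarrow> A $$ (p, q) = A $$ (q, p)"
    using snip sym_matsD(2) by (auto simp: has_SNIP_def)
  have rU: "r \<in> U" using U(3) w by blast
  have RU: "R \<subseteq> U"
  proof
    fix p
    assume "p \<in> R"
    then have "(r, p) \<in> ?rel\<^sup>*" by (simp add: R_def)
    then show "p \<in> U" by (cases rule: rtranclE) (use rU in auto)
  qed
  have closed: "A $$ (p, q) = 0" if "p \<in> R" "q \<in> U" "q \<notin> R" for p q
  proof (rule ccontr)
    assume "A $$ (p, q) \<noteq> 0"
    then have "(p, q) \<in> ?rel" using that RU by auto
    then show False using that by (auto simp: R_def intro: rtrancl_into_rtrancl)
  qed
  \<comment> \<open>Row \<open>p\<close> in R does not see the discarded entries: A vanishes between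
    R and the rest of \<open>U\<close>, and \<open>y\<close> vanishes outside \<open>U\<close>. Any
    other row \<open>p\<close> off the root lies in \<open>U\<close> and does not see the kept
    entries.\<close>
  have restrict: "null_off_root n A i (\<lambda>q. if q \<in> R then y q else 0)"
    if y: "null_off_root n A i y" for y
    unfolding null_off_root_def
  proof (intro allI impI)
    fix p
    assume p: "p < n" "p \<noteq> i"
    show "mat_app n A (\<lambda>q. if q \<in> R then y q else 0) p = 0"
    proof (cases "p \<in> R")
      case True
      have "mat_app n A (\<lambda>q. if q \<in> R then y q else 0) p = mat_app n A y p"
        unfolding mat_app_def
      proof (intro sum.cong refl)
        fix q
        assume "q \<in> {..<n}"
        then show "A $$ (p, q) * (if q \<in> R then y q else 0) = A $$ (p, q) * y q"
          using closed[OF True, of q] U(3)[OF y, of q] by auto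
      qed
      then show ?thesis using y p by (simp add: null_off_root_def)
    next
      case False
      have "p \<in> U" using p U(1) by auto
      then have "A $$ (p, q) = 0" if "q \<in> R" for q
        using closed[OF that _ False] sym[of p q] that RU U(2) p by auto
      then show ?thesis unfolding mat_app_def by (intro sum.neutral) auto
    qed
  qed
  \<comment> \<open>The parts of \<open>w\<close> on R and of \<open>x\<close> off R. Their disjoint
    supports make the diagonal of the symmetrized product vanish, and no edge of A joins these
    supports.\<close>
  define w' where "w' q = (if q \<in> R then w q else 0)" for q
  define x' where "x' q = x q - (if q \<in> R then x q else 0)" for q
  have w': "null_off_root n A i w'" unfolding w'_def by (rule restrict[OF w(1)])
  have x': "null_off_root n A i x'"
    using restrict[OF x(1)] x(1) unfolding x'_def by (simp add: null_off_root_def mat_app_diff)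
  have "w' r * x' s + x' r * w' s = 0"
  proof (rule has_SNIPD[OF snip i, of "\<lambda>p q. w' p * x' q + x' p * w' q"])
    show "w' p * x' q + x' p * w' q = w' q * x' p + x' q * w' p" for p q by simp
    show "w' p * x' p + x' p * w' p = 0" for p by (simp add: w'_def x'_def)
    show "w' p * x' q + x' p * w' q = 0" if "p < n" "q < n" "A $$ (p, q) \<noteq> 0" for p q
      using that closed[of p q] closed[of q p] sym[of p q] U(3)[OF x(1), of p] U(3)[OF x(1), of q]
      by (auto simp: w'_def x'_def)
    show "null_off_root n A i (\<lambda>p. w' p * x' q + x' p * w' q)" for q
      using w' x' mat_app_scale[of n A "x' q" w'] mat_app_scale[of n A "w' q" x']
      by (simp add: null_off_root_def mat_app_add mult.commute)
  qed (use w x in auto)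
  moreover have "r \<in> R" "s \<notin> R" using rs by (auto simp: R_def)
  ultimately show False using w(2) x(2) by (simp add: w'_def x'_def)
qed

text \<open>The tree edges are redundant: once the diagonal and the remaining edge entries of \<open>X\<close> vanish,
  the equations \<open>(AX)\<^sub>p\<^sub>p = 0\<close> kill the entries on the tree edges from the leaves towards the
  tree root \<open>r\<close>. These equations are available at every \<open>p \<noteq> r\<close> because the deleted row \<open>i\<close> is either
  \<open>r\<close> or outside \<open>R\<close>.\<close>

lemma SNIP_edge_bound_component:
  fixes parent d :: "nat \<Rightarrow> nat"
  assumes snip: "has_SNIP n A i" and i: "i < n"
    and R: "R \<subseteq> {..<n}" "r \<in> R" "\<And>p. p \<in> R \<Longrightarrow> p \<noteq> r \<Longrightarrow> p \<noteq> i"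
    and tree: "\<And>p. p \<in> R \<Longrightarrow> p \<noteq> r \<Longrightarrow>
      parent p \<in> R \<and> A $$ (parent p, p) \<noteq> 0 \<and> d (parent p) < d p"
    and supp: "\<And>x p. null_off_root n A i x \<Longrightarrow> p < n \<Longrightarrow> p \<notin> R \<Longrightarrow> x p = 0"
    and v: "indep_family n N v" "\<And>j. j < N \<Longrightarrow> null_off_root n A i (v j)"
  shows "(N + 1) choose 2 \<le> card {{p, q} | p q. p \<in> R \<and> q \<in> R \<and> p \<noteq> q \<and> A $$ (p, q) \<noteq> 0} + 1"
    (is "_ \<le> card ?F + 1")
proof (rule ccontr)
  assume "\<not> ?thesis"
  then have less: "card ?F + 1 < (N + 1) choose 2" by simp
  have sym: "\<And>p q. p < n \<Longrightarrow> q < n \<Longrightarrow> A $$ (p, q) = A $$ (q, p)"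
    using snip sym_matsD(2) by (auto simp: has_SNIP_def)
  have finR: "finite R" using R(1) finite_subset by blast
  have finF: "finite ?F"
    by (rule finite_subset[of _ "Pow R"]) (auto simp: finR)
  define T where "T = (\<lambda>p. {p, parent p}) ` (R - {r})"
  \<comment> \<open>Two vertices with the same tree edge would be parents of each other,
    contradicting the decrease of \<open>d\<close>.\<close>
  have "inj_on (\<lambda>p. {p, parent p}) (R - {r})"
  proof (rule inj_onI)
    fix p q
    assume "p \<in> R - {r}" "q \<in> R - {r}" "{p, parent p} = {q, parent q}"
    then show "p = q" using tree[of p] tree[of q] by (force simp: doubleton_eq_iff)
  qed
  then have cardT: "card T = card R - 1"
    unfolding T_def using finR R(2) by (simp add: card_image)
  have TF: "T \<subseteq> ?F"
  proof
    fix e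
    assume "e \<in> T"
    then obtain p where p: "p \<in> R" "p \<noteq> r" "e = {parent p, p}"
      by (auto simp: T_def insert_commute)
    then show "e \<in> ?F" using tree[OF p(1,2)] by force
  qed
  \<comment> \<open>Singletons stand for diagonal positions and pairs for non-tree edges;
    \<open>Min\<close> and \<open>Max\<close> recover the position. The count is at most |R| + |F| -
    (|R| - 1) = |F| + 1.\<close>
  define Z where "Z = (\<lambda>p. {p}) ` R \<union> (?F - T)"
  have "card Z \<le> card R + (card ?F - card T)"
    unfolding Z_def using card_Un_le card_image_le[OF finR] card_Diff_subset[OF finite_subset[OF TF finF] TF]
    by (metis (no_types, lifting) add_mono order_refl order_trans)
  moreover have "card R \<ge> 1" using R(2) finR by (simp add: Suc_le_eq card_gt_0_iff) blast
  moreover have "card T \<le> card ?F" using TF finF by (rule card_mono[rotated])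
  ultimately have cardZ: "card Z < (N + 1) choose 2" using less cardT by linarith
  have "finite Z" unfolding Z_def using finR finF by simp
  obtain X D where X: "\<And>p q. X p q = X q p" "\<And>p q. X p q = (\<Sum>s<N. D s q * v s p)"
    "\<And>z. z \<in> Z \<Longrightarrow> X (Min z) (Max z) = 0" "\<exists>p<n. \<exists>q<n. X p q \<noteq> 0"
    by (rule symmetric_product_with_zeros[OF v(1) \<open>finite Z\<close> cardZ, of Min Max]) blast
  have null: "null_off_root n A i (\<lambda>p. X p q)" for q
    unfolding X(2) null_off_root_def using v(2) by (simp add: mat_app_sum null_off_root_def)
  have outside: "X p q = 0" if "p < n" "q < n" "p \<notin> R \<or> q \<notin> R" for p q
    using that supp[OF null, of p q] supp[OF null, of q p] X(1)[of p q] by auto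
  have diag: "X p p = 0" if "p < n" for p
  proof (cases "p \<in> R")
    case True
    then have "{p} \<in> Z" by (simp add: Z_def)
    from X(3)[OF this] show ?thesis by simp
  qed (use outside that in auto)
  have edge: "X p q = 0" if "{p, q} \<in> Z" for p q
    using X(3)[OF that] X(1)[of p q] by (auto simp: min_def max_def split: if_splits)
  have tree_edge: "X p (parent p) = 0" if "p \<in> R" "p \<noteq> r" for p
    using that
  \<comment> \<open>The measure decreases as \<open>d\<close> grows, so children are settled before
    their parent.\<close>
  proof (induction "Max (d ` R) - d p" arbitrary: p rule: less_induct)
    case less
    let ?pp = "parent p"
    have p: "p < n" "p \<noteq> i" "?pp \<in> R" "?pp < n" "A $$ (?pp, p) \<noteq> 0" "d ?pp < d p"
      using less.prems R tree by auto
    \<comment> \<open>In (AX)_pp = 0 only the parent term may survive: the diagonal, positions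
      outside R and non-tree edges give 0, and a tree edge not leading to the parent leads to a
      child, covered by induction.\<close>
    have zero: "A $$ (p, q) * X q p = 0" if q: "q < n" "q \<noteq> ?pp" for q
    proof (cases "q \<in> R \<and> q \<noteq> p \<and> A $$ (p, q) \<noteq> 0")
      case False
      then show ?thesis using outside[of q p] diag p(1) q(1) by auto
    next
      case True
      then have F: "{p, q} \<in> ?F" using less.prems by blast
      show ?thesis
      proof (cases "{p, q} \<in> T")
        case False
        then show ?thesis using F edge[of p q] X(1)[of p q] by (simp add: Z_def)
      next
        case T: True
        then have q_r: "q \<noteq> r" and pq: "p = parent q"
          using q(2) True unfolding T_def by (auto simp: doubleton_eq_iff)
        have "d p < d q" using tree[of q] True q_r pq by auto
        moreover have "d q \<le> Max (d ` R)" using True finR by simp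
        ultimately have "X q (parent q) = 0" using less.hyps[of q] True q_r by simp
        then show ?thesis using pq by simp
      qed
    qed
    have "0 = mat_app n A (\<lambda>q. X q p) p" using null p by (simp add: null_off_root_def)
    also have "\<dots> = A $$ (p, ?pp) * X ?pp p + (\<Sum>q\<in>{..<n} - {?pp}. A $$ (p, q) * X q p)"
      unfolding mat_app_def using p(4) by (intro sum.remove) auto
    also have "(\<Sum>q\<in>{..<n} - {?pp}. A $$ (p, q) * X q p) = 0"
      using zero by (intro sum.neutral) auto
    finally have "X ?pp p = 0" using p sym[of p ?pp] by simp
    then show ?case using X(1)[of p ?pp] by simp
  qed
  have "X p q = 0" if "p < n" "q < n" for p q
  proof (rule has_SNIPD[OF snip i X(1) diag _ null that])
    fix p q
    assume pq: "p < n" "q < n" "A $$ (p, q) \<noteq> 0"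
    show "X p q = 0"
    proof (cases "p \<in> R \<and> q \<in> R \<and> p \<noteq> q")
      case False
      then show ?thesis using outside diag pq by auto
    next
      case True
      then have "{p, q} \<in> ?F" using pq by blast
      show ?thesis
      proof (cases "{p, q} \<in> T")
        case False
        then show ?thesis using edge[of p q] \<open>{p, q} \<in> ?F\<close> by (simp add: Z_def)
      next
        case True
        then obtain s where "s \<in> R" "s \<noteq> r" "{p, q} = {s, parent s}" by (auto simp: T_def)
        then show ?thesis
          using tree_edge[of s] X(1)[of p q] by (auto simp: doubleton_eq_iff)
      qed
    qed
  qed
  then show False using X(4) by blast
qed

text \<open>R is the component of \<open>r\<close> within \<open>U\<close>. The vector
  \<open>w\<close> puts \<open>r\<close> into the support of W, so connectedness confines W to R.
  The condition \<open>r = i\<close> or i outside \<open>U\<close> makes row \<open>p\<close>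
  available for every p in R other than \<open>r\<close>.\<close>

lemma SNIP_edge_bound:
  assumes A: "A \<in> graph_mats n E" and snip: "has_SNIP n A i" and i: "i < n"
    and U: "{..<n} - {i} \<subseteq> U" "U \<subseteq> {..<n}" "r = i \<or> i \<notin> U"
      "\<And>x q. null_off_root n A i x \<Longrightarrow> q < n \<Longrightarrow> q \<notin> U \<Longrightarrow> x q = 0"
    and w: "null_off_root n A i w" "w r \<noteq> 0" "r < n"
    and v: "indep_family n N v" "\<And>j. j < N \<Longrightarrow> null_off_root n A i (v j)"
    and E: "finite E"
  shows "(N + 1) choose 2 \<le> card {e \<in> E. e \<subseteq> U} + 1"
proof -
  define rel where "rel = {(p, q). p \<in> U \<and> q \<in> U \<and> A $$ (p, q) \<noteq> 0}"
  define R where "R = {p. (r, p) \<in> rel\<^sup>*}"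
  have rU: "r \<in> U" using U(4) w by blast
  have RU: "R \<subseteq> U"
  proof
    fix p
    assume "p \<in> R"
    then have "(r, p) \<in> rel\<^sup>*" by (simp add: R_def)
    then show "p \<in> U" by (cases rule: rtranclE) (use rU in \<open>auto simp: rel_def\<close>)
  qed
  obtain d :: "nat \<Rightarrow> nat" and parent where tree: "\<And>p. (r, p) \<in> rel\<^sup>* \<Longrightarrow> p \<noteq> r \<Longrightarrow>
      (r, parent p) \<in> rel\<^sup>* \<and> (parent p, p) \<in> rel \<and> d (parent p) < d p"
    by (rule rtrancl_parent) blast
  let ?F = "{{p, q} | p q. p \<in> R \<and> q \<in> R \<and> p \<noteq> q \<and> A $$ (p, q) \<noteq> 0}"
  have "(N + 1) choose 2 \<le> card ?F + 1"
  proof (rule SNIP_edge_bound_component[OF snip i _ _ _ _ _ v])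
    show "R \<subseteq> {..<n}" "r \<in> R" using RU U(2) by (auto simp: R_def)
    show "p \<noteq> i" if "p \<in> R" "p \<noteq> r" for p using that U(3) RU by auto
    show "parent p \<in> R \<and> A $$ (parent p, p) \<noteq> 0 \<and> d (parent p) < d p"
      if "p \<in> R" "p \<noteq> r" for p
      using tree[of p] that by (auto simp: R_def rel_def)
    show "x p = 0" if "null_off_root n A i x" "p < n" "p \<notin> R" for x p
    proof (rule ccontr)
      assume "x p \<noteq> 0"
      have "(r, p) \<in> rel\<^sup>*"
        unfolding rel_def
        by (rule SNIP_support_connected[OF snip i U(1,2) _ w that(1) \<open>x p \<noteq> 0\<close> that(2)]) (rule U(4))
      then show False using that(3) by (simp add: R_def)
    qed
  qed
  also have "card ?F \<le> card {e \<in> E. e \<subseteq> U}"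
  proof (rule card_mono)
    show "?F \<subseteq> {e \<in> E. e \<subseteq> U}"
    proof
      fix e
      assume "e \<in> ?F"
      then obtain p q where pq: "p \<in> U" "q \<in> U" "p \<noteq> q" "A $$ (p, q) \<noteq> 0" "e = {p, q}"
        using RU by blast
      then have "p < n" "q < n" using U(2) by auto
      then show "e \<in> {e \<in> E. e \<subseteq> U}" using A pq by (simp add: graph_mats_def)
    qed
  qed (use E in simp)
  finally show ?thesis by simp
qed

section \<open>Attainment of the maximum\<close>

text \<open>Diagonal entries n make A strictly diagonally dominant, hence injective. Under the SNIP
  conditions AX has only row \<open>i\<close>, so X has rank at most one; being symmetric with zero
  diagonal, it is zero.\<close>

lemma exists_SNIP_matrix_kernel_dim_0:
  assumes i: "i < n"
  obtains A where "A \<in> graph_mats n E" "has_SNIP n A i" "kernel_dim A = 0"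
proof -
  define A where "A = mat n n (\<lambda>(p, q). if p = q then real n else if {p, q} \<in> E then 1 else 0)"
  have carrier: "A \<in> carrier_mat n n" by (simp add: A_def)
  have A: "A \<in> sym_mats n" "A \<in> graph_mats n E"
    by (auto simp: A_def sym_mats_def graph_mats_def insert_commute intro!: eq_matI)
  have inj: "x p = 0" if x: "\<And>p. p < n \<Longrightarrow> mat_app n A x p = 0" and p: "p < n" for x p
  proof -
    \<comment> \<open>At an entry of largest modulus, row \<open>m\<close> yields n |x_m| \<le> (n -
      1) |x_m|.\<close>
    obtain m where m: "m < n" "\<And>q. q < n \<Longrightarrow> \<bar>x q\<bar> \<le> \<bar>x m\<bar>"
    proof -
      have "Max ((\<lambda>q. \<bar>x q\<bar>) ` {..<n}) \<in> (\<lambda>q. \<bar>x q\<bar>) ` {..<n}" using i by (intro Max_in) auto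
      then obtain m where "m < n" "Max ((\<lambda>q. \<bar>x q\<bar>) ` {..<n}) = \<bar>x m\<bar>" by auto
      then show thesis using that[of m] by (metis Max_ge finite_imageI finite_lessThan imageI lessThan_iff)
    qed
    have "real n * x m = - (\<Sum>q\<in>{..<n} - {m}. A $$ (m, q) * x q)"
      using x[OF m(1)] m(1) unfolding mat_app_def
      by (subst (asm) sum.remove[of _ m]) (auto simp: A_def)
    then have "real n * \<bar>x m\<bar> = \<bar>\<Sum>q\<in>{..<n} - {m}. A $$ (m, q) * x q\<bar>"
      by (metis abs_minus_cancel abs_mult abs_of_nat)
    also have "\<dots> \<le> (\<Sum>q\<in>{..<n} - {m}. \<bar>x m\<bar>)"
    proof (rule order_trans[OF sum_abs sum_mono])
      fix q
      assume "q \<in> {..<n} - {m}"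
      then show "\<bar>A $$ (m, q) * x q\<bar> \<le> \<bar>x m\<bar>" using m by (auto simp: A_def)
    qed
    also have "\<dots> = (real n - 1) * \<bar>x m\<bar>" using m(1) by (simp add: of_nat_diff)
    finally have "x m = 0" by (simp add: left_diff_distrib)
    then show ?thesis using m(2)[OF p] by simp
  qed
  have "kernel_dim A = 0"
  proof (rule ccontr)
    assume "kernel_dim A \<noteq> 0"
    obtain v where v: "indep_family n (kernel_dim A) v"
      "\<And>j p. j < kernel_dim A \<Longrightarrow> p < n \<Longrightarrow> mat_app n A (v j) p = 0"
      by (rule kernel_basis_family[OF carrier]) blast
    have "v j p = 0" if "j < kernel_dim A" "p < n" for j p
      using inj[OF v(2)[OF that(1)] that(2)] .
    then show False
      using indep_familyD[OF v(1), of "\<lambda>_. 1" 0] \<open>kernel_dim A \<noteq> 0\<close> by simp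
  qed
  moreover have "has_SNIP n A i"
    unfolding has_SNIP_def
  proof (intro conjI ballI impI A(1))
    fix X
    assume X: "X \<in> sym_mats n" and cond: "hadamard_mat A X = 0\<^sub>m n n \<and>
      hadamard_mat (1\<^sub>m n) X = 0\<^sub>m n n \<and> del_row (A * X) i = 0\<^sub>m (n - 1) n"
    note XC = sym_matsD(1)[OF X]
    define t where "t q = mat_app n A (\<lambda>p. X $$ (p, q)) i" for q
    have diag: "\<And>p. p < n \<Longrightarrow> X $$ (p, p) = 0"
      and app: "\<And>p q. p < n \<Longrightarrow> q < n \<Longrightarrow> mat_app n A (\<lambda>p. X $$ (p, q)) p = (if p = i then t q else 0)"
      using cond SNIP_conditions_iff[OF carrier XC i] by (auto simp: null_off_root_def t_def)
    have "X $$ (p, q) = 0" if pq: "p < n" "q < n" for p q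
    proof (cases "t q = 0")
      case True
      then show ?thesis using inj[of "\<lambda>p. X $$ (p, q)" p] app pq by simp
    next
      case False
      \<comment> \<open>Columns p and q of AX are t_p e_i and t_q e_i, so this combination of
        columns of X is in the kernel of A and vanishes; entry q is read off because X_qq =
        0.\<close>
      have "t q * X $$ (q, p) - t p * X $$ (q, q) = 0"
        using app pq by (intro inj[of "\<lambda>r. t q * X $$ (r, p) - t p * X $$ (r, q)"])
          (simp_all add: mat_app_diff mat_app_scale)
      then show ?thesis using False diag pq sym_matsD(2)[OF X pq] by simp
    qed
    then show "X = 0\<^sub>m n n" using XC by (intro eq_matI) auto
  qed
  ultimately show thesis using that A(2) by blast
qed

lemma kernel_dim_le:
  fixes A :: "real mat"
  assumes "A \<in> carrier_mat m n"
  shows "kernel_dim A \<le> n"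
  by (rule kernel_basis_family[OF assms]) (rule indep_family_le_dim)

text \<open>\<open>Max\<close> ranges over a finite set, as nullities are bounded by n, and a
  nonempty one: a matrix with k = 0 is admissible whatever its l.\<close>

lemma xixi_attained:
  assumes i: "i < n"
  obtains A k l where "A \<in> graph_mats n E" "has_SNIP n A i" "nullity_pair A i = (k, l)"
    "k \<le> l" "xixi n E i = k + l"
proof -
  let ?S = "{k + l | k l. k \<le> l \<and>
     (\<exists>A \<in> graph_mats n E. has_SNIP n A i \<and> nullity_pair A i = (k, l))}"
  obtain A where "A \<in> graph_mats n E" "has_SNIP n A i" "kernel_dim A = 0"
    using exists_SNIP_matrix_kernel_dim_0[OF i] by blast
  then have "kernel_dim (mat_delete A i i) \<in> ?S"
    by (force simp: nullity_pair_def)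
  moreover have "?S \<subseteq> {..n + n}"
  proof
    fix s
    assume "s \<in> ?S"
    then obtain A where A: "A \<in> graph_mats n E"
      "s = kernel_dim A + kernel_dim (mat_delete A i i)" by (auto simp: nullity_pair_def)
    have carrier: "A \<in> carrier_mat n n" using A(1) by (simp add: graph_mats_def sym_matsD(1))
    have "kernel_dim (mat_delete A i i) \<le> n - 1"
      by (rule kernel_dim_le[OF mat_delete_carrier[OF carrier]])
    then show "s \<in> {..n + n}" using kernel_dim_le[OF carrier] A(2) by simp
  qed
  then have "finite ?S" by (rule finite_subset) simp
  ultimately have "xixi n E i \<in> ?S" unfolding xixi_def by (intro Max_in) auto
  then show thesis using that by auto
qed

theorem theorem7p4:
  fixes n i k l :: nat and E :: "nat set set"
  assumes "rooted_graph n E i"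
    and "xixi n E i = k + l"
    and "k \<le> l" and "l \<le> k + 1"
  shows "(k = l \<longrightarrow> card E + 1 \<ge> (k + 2) choose 2)
    \<and> (k < l \<longrightarrow> card (del_vertex E i) + 1 \<ge> (l + 1) choose 2)
    \<and> (let m = nat \<lceil>(real (xixi n E i) + 3) / 2\<rceil> in card E + 1 \<ge> m choose 2)"
proof -
  have i: "i < n" and edges: "\<And>e. e \<in> E \<Longrightarrow> e \<subseteq> {..<n}"
    using assms(1) by (auto simp: rooted_graph_def simple_graph_def)
  have finE: "finite E" using edges by (intro finite_subset[of E "Pow {..<n}"]) auto
  obtain A k' l' where A: "A \<in> graph_mats n E" "has_SNIP n A i" "nullity_pair A i = (k', l')"
    "k' \<le> l'" "xixi n E i = k' + l'"
    using xixi_attained[OF i] by blast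
  have sym: "A \<in> sym_mats n" using A(1) by (simp add: graph_mats_def)
  show ?thesis
  proof (cases rule: nullity_pair_cases[OF sym i A(3,4)])
    case (1 v w)
    \<comment> \<open>Both pairs have gap 0 or 1, so the parity of the common sum identifies
      them.\<close>
    then have kl: "k = l" "l' = k" using assms A(5) by presburger+
    have "{e \<in> E. e \<subseteq> {..<n}} = E" using edges by auto
    \<comment> \<open>Here \<open>U\<close> is the whole vertex set and \<open>r\<close> is the
      root; W has dimension k + 1.\<close>
    moreover have "(l' + 1 + 1) choose 2 \<le> card {e \<in> E. e \<subseteq> {..<n}} + 1"
      by (rule SNIP_edge_bound[OF A(1,2) i _ _ _ _ 1(4,5) i 1(2,3) finE]) auto
    ultimately have bound: "(k + 2) choose 2 \<le> card E + 1" using kl by (simp add: numeral_2_eq_2)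
    have "\<lceil>(real (xixi n E i) + 3) / 2\<rceil> = int (k + 2)"
      unfolding assms(2) using kl by (intro ceiling_unique) auto
    then have m: "nat \<lceil>(real (xixi n E i) + 3) / 2\<rceil> = k + 2" by (simp only: nat_int)
    show ?thesis unfolding Let_def m using bound kl by simp
  next
    case (2 v)
    then have kl: "l = k + 1" "l' = l" using assms A(5) by presburger+
    have del: "{e \<in> E. e \<subseteq> {..<n} - {i}} = del_vertex E i" using edges by (auto simp: del_vertex_def)
    \<comment> \<open>As l' = k' + 1 is positive, \<open>v 0\<close> exists and is nonzero by
      independence; any index of its support serves as \<open>r\<close>.\<close>
    obtain r where r: "r < n" "v 0 r \<noteq> 0"
    proof (rule ccontr)
      assume "\<not> thesis"
      then have "v 0 r = 0" if "r < n" for r using that \<open>\<And>r. r < n \<Longrightarrow> v 0 r \<noteq> 0 \<Longrightarrow> thesis\<close> by blast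
      then have "(\<Sum>j<l'. (if j = 0 then 1 else 0) * v j p) = 0" if "p < n" for p
        using that by (intro sum.neutral) auto
      then show False using indep_familyD[OF 2(2), of "\<lambda>j. if j = 0 then 1 else 0" 0] 2(1) by simp
    qed
    have v0: "null_off_root n A i (v 0)" using 2(1,3) by simp
    \<comment> \<open>Now \<open>U\<close> omits the root, where W vanishes, and W has dimension
      l.\<close>
    have bound: "(l + 1) choose 2 \<le> card (del_vertex E i) + 1"
      unfolding del[symmetric] kl(2)[symmetric]
      by (rule SNIP_edge_bound[OF A(1,2) i, where w = "v 0" and r = r and v = v])
        (use 2 v0 r finE in auto)
    have "card (del_vertex E i) \<le> card E" using finE by (intro card_mono) (auto simp: del_vertex_def)
    \<comment> \<open>With k = l - 1 the value (k + l + 3)/2 is exactly l + 1, so the overall bound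
      follows from (b), because G - i has no more edges than G.\<close>
    moreover have "\<lceil>(real (xixi n E i) + 3) / 2\<rceil> = int (l + 1)"
      unfolding assms(2) using kl by (intro ceiling_unique) auto
    then have m: "nat \<lceil>(real (xixi n E i) + 3) / 2\<rceil> = l + 1" by (simp only: nat_int)
    ultimately show ?thesis unfolding Let_def m using bound kl by simp
  qed
qed

end
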